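(* Let $k$, $m$ and $n$ be integers with $k\geq 3$, $m\geq 3$ and $n\geq (k-1)m+1$, and let $G$ be a connected (finite, simple, undirected) bipartite graph with bipartition $A\cup B$, where $|A|=m$ and $|B|=n$. If $$q(G)\geq q(K_{1,k-1}\nabla K_{m-1,n-k+1}),$$ then $G$ contains a spanning tree $T$ with $d_T(v)\geq k$ for every $v\in A$, unless $G=K_{1,k-1}\nabla K_{m-1,n-k+1}$ (equality of graphs meaning isomorphism).
   Context: All graphs are finite, simple and undirected. For a graph $G$, $d_G(v)$ denotes the degree of the vertex $v$ in $G$. The signless Laplacian matrix of $G$ is $Q(G)=D(G)+A(G)$, where $D(G)$ is the diagonal matrix of vertex degrees and $A(G)$ is the adjacency matrix of $G$; $q(G)$ denotes the largest eigenvalue of $Q(G)$ (the signless Laplacian spectral radius of $G$). $K_{a,b}$ denotes the complete bipartite graph with (ordered) bipartition $(A,B)$, where $|A|=a$ and $|B|=b$. Given two vertex-disjoint bipartite graphs $G_1$ with ordered bipartition $(A_1,B_1)$ and $G_2$ with ordered bipartition $(A_2,B_2)$, $G_1\nabla G_2$ denotes the graph obtained from the disjoint union $G_1\cup G_2$ by adding all possible edges between $A_2$ and $B_1$. Thus $K_{1,k-1}\nabla K_{m-1,n-k+1}$ is the bipartite graph with parts $A_1\cup A_2$ and $B_1\cup B_2$, where $|A_1|=1$, $|A_2|=m-1$, $|B_1|=k-1$, $|B_2|=n-k+1$, in which the vertex of $A_1$ is adjacent exactly to all vertices of $B_1$ and every vertex of $A_2$ is adjacent to all vertices of $B_1\cup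 B_2$. *)

theory Defs
  imports
    "Graph_Theory.Digraph_Component"
    "Graph_Theory.Digraph_Isomorphism"
    "Jordan_Normal_Form.Spectral_Radius"
begin

text \<open>
  Finite simple undirected graphs are the symmetric loop-free digraphs of the locale
  \<^locale>\<open>pair_graph\<close>: an undirected edge \<open>uv\<close> is the pair of arcs
  \<open>(u, v)\<close> and \<open>(v, u)\<close>, so the degree of a vertex is its
  \<^const>\<open>out_degree\<close>.
\<close>

abbreviation degree_of :: "'a pair_pre_digraph \<Rightarrow> 'a \<Rightarrow> nat" where
  "degree_of G v \<equiv> out_degree (with_proj G) v"

text \<open>
  \<^const>\<open>tree\<close> is not usable here: in a symmetric digraph the walk \<open>u, v, u\<close>
  along an edge and back is a \<^const>\<open>pre_digraph.cycle\<close>. The cycles of the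
  undirected graph are those of length at least 3.
\<close>

definition undirected_tree :: "'a pair_pre_digraph \<Rightarrow> bool" where
  "undirected_tree T \<longleftrightarrow>
     pair_graph T \<and> Digraph_Component.connected (with_proj T) \<and>
     \<not> (\<exists>p. pre_digraph.cycle (with_proj T) p \<and> 3 \<le> length p)"

definition undirected_spanning_tree ::
  "'a pair_pre_digraph \<Rightarrow> 'a pair_pre_digraph \<Rightarrow> bool" where
  "undirected_spanning_tree T G \<longleftrightarrow>
     undirected_tree T \<and> spanning (with_proj T) (with_proj G)"

definition bipartition :: "'a pair_pre_digraph \<Rightarrow> 'a set \<Rightarrow> 'a set \<Rightarrow> bool" where
  "bipartition G A B \<longleftrightarrow>
     pverts G = A \<union> B \<and> A \<inter> B = {} \<and> parcs G \<subseteq> A \<times> B \<union> B \<times> A"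

text \<open>
  The rows and columns of the following matrices are indexed by the positions in a list
  \<open>vs\<close> of the vertices.
\<close>

definition degree_matrix :: "'a pair_pre_digraph \<Rightarrow> 'a list \<Rightarrow> real mat" where
  "degree_matrix G vs = mat (length vs) (length vs)
     (\<lambda>(i, j). if i = j then real (degree_of G (vs ! i)) else 0)"

definition adjacency_matrix :: "'a pair_pre_digraph \<Rightarrow> 'a list \<Rightarrow> real mat" where
  "adjacency_matrix G vs = mat (length vs) (length vs)
     (\<lambda>(i, j). if (vs ! i, vs ! j) \<in> parcs G then 1 else 0)"

definition signless_laplacian :: "'a pair_pre_digraph \<Rightarrow> 'a list \<Rightarrow> real mat" where
  "signless_laplacian G vs = degree_matrix G vs + adjacency_matrix G vs"

text \<open>
  Different enumerations of the vertices give permutation-similar matrices, so the spectrum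
  does not depend on the enumeration chosen by \<open>SOME\<close>. The matrix is real symmetric,
  so all its eigenvalues are real and the maximum over the real spectrum is the largest one.
\<close>

definition signless_spectral_radius :: "'a pair_pre_digraph \<Rightarrow> real" where
  "signless_spectral_radius G =
     Max (spectrum (signless_laplacian G (SOME vs. distinct vs \<and> set vs = pverts G)))"

text \<open>A bipartite graph together with its ordered bipartition \<open>(A, B)\<close>:\<close>

type_synonym 'a bipartite_graph = "'a pair_pre_digraph \<times> 'a set \<times> 'a set"

definition complete_bipartite :: "nat \<Rightarrow> nat \<Rightarrow> (nat + nat) bipartite_graph" where
  "complete_bipartite a b =
     (let A = Inl ` {..<a}; B = Inr ` {..<b}
      in (\<lparr>pverts = A \<union> B, parcs = A \<times> B \<union> B \<times> A\<rparr>, A, B))"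

text \<open>The sum type makes the two vertex sets disjoint.\<close>

fun nabla :: "'a bipartite_graph \<Rightarrow> 'b bipartite_graph \<Rightarrow> ('a + 'b) bipartite_graph"
  (infixl \<open>\<nabla>\<close> 65) where
  "(G1, A1, B1) \<nabla> (G2, A2, B2) =
     (\<lparr>pverts = Inl ` pverts G1 \<union> Inr ` pverts G2,
       parcs = map_prod Inl Inl ` parcs G1 \<union> map_prod Inr Inr ` parcs G2 \<union>
         Inr ` A2 \<times> Inl ` B1 \<union> Inl ` B1 \<times> Inr ` A2\<rparr>,
      Inl ` A1 \<union> Inr ` A2, Inl ` B1 \<union> Inr ` B2)"

definition extremal_graph ::
  "nat \<Rightarrow> nat \<Rightarrow> nat \<Rightarrow> ((nat + nat) + (nat + nat)) pair_pre_digraph" where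
  "extremal_graph k m n =
     fst (complete_bipartite 1 (k - 1) \<nabla> complete_bipartite (m - 1) (n - k + 1))"

end

theory Submission
  imports Defs
begin

text \<open>
  If every nonempty \<open>S \<subseteq> A\<close> has more than \<open>(k - 1) |S|\<close> neighbours, then a minimal set of edges with
  this property is a forest in which all vertices of \<open>A\<close> have degree \<open>k\<close>, and it extends to a
  spanning tree. Otherwise some \<open>S\<close> of size \<open>s < m\<close> violates the condition, and \<open>G\<close> is a spanning
  subgraph of \<open>H\<^sub>s = K\<^bsub>s,b\<^esub> \<nabla> K\<^bsub>m-s,n-b\<^esub>\<close> with \<open>b = (k - 1) s\<close>. The largest eigenvalue of \<open>H\<^sub>1\<close> exceeds
  \<open>m + n - 1\<close>, whereas for \<open>s \<ge> 2\<close> a positive vector \<open>v\<close> with \<open>Q(H\<^sub>s) v \<le> (m + n - 1) v\<close> shows that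
  \<open>q(G) \<le> m + n - 1\<close>. For \<open>s = 1\<close> the positive eigenvector of \<open>H\<^sub>1\<close> forces \<open>G = H\<^sub>1\<close>.
\<close>

section \<open>Spanning trees with large degrees on one side\<close>

lemma (in pair_graph) connected_iff_rtrancl:
  "Digraph_Component.connected (with_proj G) \<longleftrightarrow>
     pverts G \<noteq> {} \<and> (\<forall>u\<in>pverts G. \<forall>v\<in>pverts G. (u, v) \<in> (parcs G)\<^sup>*)"
proof -
  \<comment> \<open>Connectedness is defined through the symmetric closure, which adds nothing to a
    symmetric arc relation; and since every arc ends at a vertex, walks cannot leave the vertex
    set.\<close>
  have arcs: "parcs (mk_symmetric (with_proj G)) = parcs G"
    using arcs_symmetric by (auto simp: mk_symmetric_def)
  have verts: "pverts (mk_symmetric (with_proj G)) = pverts G"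
    by (simp add: mk_symmetric_def)
  have "(u, v) \<in> rtrancl_on (pverts G) (parcs G) \<longleftrightarrow> (u, v) \<in> (parcs G)\<^sup>*"
    if "u \<in> pverts G" "v \<in> pverts G" for u v
    using that rtrancl_consistent_rtrancl_on[of u v "parcs G" "pverts G"]
      rtrancl_on_rtranclI[of u v] in_arcsD2 by blast
  then show ?thesis
    unfolding Digraph_Component.connected_def strongly_connected_def reachable_def
      with_proj_simps arcs verts
    by blast
qed

lemma (in pair_fin_digraph) degree_of_eq_card_Image: "degree_of G v = card (parcs G `` {v})"
proof -
  have "out_arcs (with_proj G) v = Pair v ` (parcs G `` {v})"
    by (auto simp: out_arcs_def)
  then show ?thesis
    by (simp add: out_degree_def card_image inj_on_def)
qed

text \<open>A closed walk through distinct vertices, indexed by the naturals modulo its length.\<close>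

definition cyclic_sequence :: "'a rel \<Rightarrow> nat \<Rightarrow> (nat \<Rightarrow> 'a) \<Rightarrow> bool" where
  "cyclic_sequence E L c \<longleftrightarrow>
     (\<forall>i. (c i, c (Suc i)) \<in> E) \<and> (\<forall>i j. c i = c j \<longleftrightarrow> i mod L = j mod L)"

lemma pcas_nth:
  assumes "pcas u p v" "i < length p"
  shows "fst (p ! i) = (if i = 0 then u else snd (p ! (i - 1)))"
  using assms by (induction p arbitrary: u i) (auto simp: nth_Cons split: nat.splits)

lemma pcas_last: "pcas u p v \<Longrightarrow> p \<noteq> [] \<Longrightarrow> snd (last p) = v"
proof (induction p arbitrary: u)
  case (Cons e p)
  then show ?case by (cases p) auto
qed simp

lemma pawalk_verts_eq: "pcas u p v \<Longrightarrow> pawalk_verts u p = u # map snd p"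
  by (induction p arbitrary: u) auto

text \<open>The sequence lists the heads of the arcs of \<open>p\<close>, repeated periodically. A
  digraph cycle repeats no vertex after its first one, so these heads are distinct.\<close>

lemma cycle_imp_cyclic_sequence:
  assumes "pre_digraph.cycle (with_proj G) p"
  obtains c where "cyclic_sequence (parcs G) (length p) c"
proof -
  obtain u where u: "pre_digraph.awalk (with_proj G) u p u"
    "distinct (tl (pre_digraph.awalk_verts (with_proj G) u p))" and ne: "p \<noteq> []"
    using assms by (auto simp: pre_digraph.cycle_def)
  then have cas: "pcas u p u" and sub: "set p \<subseteq> parcs G"
    by (auto simp: pre_digraph.awalk_def cas_with_proj_eq)
  have dist: "distinct (map snd p)"
    using u(2) pawalk_verts_eq[OF cas] by (simp add: awalk_verts_with_proj_eq)
  let ?L = "length p"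
  define c where "c i = snd (p ! (i mod ?L))" for i
  have L: "?L > 0" using ne by simp
  have arc: "(c i, c (Suc i)) \<in> parcs G" for i
  proof -
    let ?j = "Suc i mod ?L"
    have j: "?j < ?L" using L by simp
    have "fst (p ! ?j) = c i"
    proof (cases "?j = 0")
      \<comment> \<open>Wrap-around: the first arc starts at \<open>u\<close>, which is the head of
        the last arc.\<close>
      case True
      then have "i mod ?L = ?L - 1"
        by (metis L One_nat_def Suc_pred diff_Suc_1 mod_Suc nat.distinct(1))
      then have "c i = u"
        using pcas_last[OF cas ne] ne by (simp add: c_def last_conv_nth)
      then show ?thesis
        using pcas_nth[OF cas j] True by simp
    next
      case False
      then have "?j - 1 = i mod ?L"
        by (auto simp: mod_Suc)
      then show ?thesis
        using pcas_nth[OF cas j] False by (simp add: c_def)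
    qed
    moreover have "p ! ?j \<in> parcs G"
      using sub j by auto
    ultimately show ?thesis
      by (metis c_def prod.collapse)
  qed
  have "c i = c j \<longleftrightarrow> i mod ?L = j mod ?L" for i j
    using nth_eq_iff_index_eq[OF dist, of "i mod ?L" "j mod ?L"] L by (simp add: c_def)
  with arc show thesis
    by (intro that[of c]) (simp add: cyclic_sequence_def)
qed

lemma mod_add_neq:
  assumes "0 < t" "t < L"
  shows "(i + t) mod L \<noteq> i mod (L::nat)"
proof
  assume "(i + t) mod L = i mod L"
  then have "L dvd t"
    using mod_eq_dvd_iff_nat[of i "i + t" L] by simp
  then show False using assms by (auto dest: dvd_imp_le)
qed

text \<open>The other arcs of the cycle lead from \<open>c (Suc j)\<close> round to
  \<open>c j\<close>, and symmetry reverses this detour, so walks replace both deleted arcs.\<close>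

lemma rtrancl_remove_cycle_edge:
  assumes "sym E" and c: "cyclic_sequence E L c" and L: "3 \<le> L"
  shows "(E - {(c j, c (Suc j)), (c (Suc j), c j)})\<^sup>* = E\<^sup>*" (is "?E'\<^sup>* = _")
proof -
  have eq: "c i = c i' \<longleftrightarrow> i mod L = i' mod L" and arc: "(c i, c (Suc i)) \<in> E" for i i'
    using c by (auto simp: cyclic_sequence_def)
  have "(c (Suc j), c (Suc j + t)) \<in> ?E'\<^sup>*" if "t \<le> L - 1" for t
    using that
  proof (induction t)
    case (Suc t)
    \<comment> \<open>The arc leaving \<open>c (Suc j + t)\<close> is not deleted: its tail is not
      \<open>c j\<close>, and it is the reversed arc only if \<open>t = 0\<close> and it ends at
      \<open>c j\<close>, which \<open>3 \<le> L\<close> excludes.\<close>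
    have "c (Suc j + t) \<noteq> c j"
      using eq[of "j + Suc t" j] mod_add_neq[of "Suc t" L j] Suc.prems L by auto
    moreover have "c (Suc j + t) \<noteq> c (Suc j) \<or> c (Suc (Suc j + t)) \<noteq> c j"
    proof (cases "t = 0")
      case True
      then show ?thesis using eq[of "j + 2" j] mod_add_neq[of 2 L j] L by auto
    next
      case False
      then show ?thesis using eq[of "Suc j + t" "Suc j"] mod_add_neq[of t L "Suc j"] Suc.prems by auto
    qed
    ultimately have "(c (Suc j + t), c (Suc (Suc j + t))) \<in> ?E'"
      using arc by auto
    then show ?case using Suc by (auto intro: rtrancl_into_rtrancl)
  qed simp
  from this[of "L - 1"] have "(c (Suc j), c (j + L)) \<in> ?E'\<^sup>*"
    using L by auto
  then have fwd: "(c (Suc j), c j) \<in> ?E'\<^sup>*"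
    using eq[of "j + L" j] by simp
  have "sym ?E'" using \<open>sym E\<close> by (auto simp: sym_def)
  then have bwd: "(c j, c (Suc j)) \<in> ?E'\<^sup>*"
    using fwd by (meson symD sym_rtrancl)
  have "E \<subseteq> ?E'\<^sup>*" using fwd bwd by auto
  then show ?thesis
    by (intro rtrancl_subset[symmetric]) auto
qed

text \<open>
  A cycle through \<open>l\<close> vertices of \<open>A\<close> has \<open>l\<close> vertices in \<open>B\<close>, and each of its \<open>l\<close>
  vertices in \<open>A\<close> has at most \<open>k - 2\<close> neighbours off the cycle, so that they have at most
  \<open>(k - 1) l\<close> neighbours together.
\<close>

lemma no_cyclic_sequence_if_expanding:
  fixes E :: "'a rel"
  assumes sym: "sym E" and bip: "E \<subseteq> A \<times> B \<union> B \<times> A" "A \<inter> B = {}"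
    and fin: "finite A" "finite B"
    and deg: "\<And>v. v \<in> A \<Longrightarrow> card (E `` {v}) = k"
    and exp: "\<And>S. S \<subseteq> A \<Longrightarrow> S \<noteq> {} \<Longrightarrow> (k - 1) * card S < card (E `` S)"
    and L: "3 \<le> L"
  shows "\<not> cyclic_sequence E L c"
proof
  assume "cyclic_sequence E L c"
  then have eq: "c i = c i' \<longleftrightarrow> i mod L = i' mod L" and arc: "(c i, c (Suc i)) \<in> E" for i i'
    by (auto simp: cyclic_sequence_def)
  define S where "S = range c \<inter> A"
  define R where "R = range c \<inter> B"
  have finS: "finite S" and finR: "finite R" using fin by (auto simp: S_def R_def)
  have "c 0 \<in> A \<or> c 1 \<in> A" using arc[of 0] bip by auto
  then have S_ne: "S \<noteq> {}" by (auto simp: S_def)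
  have EB: "E `` {v} \<subseteq> B" if "v \<in> A" for v using bip that by blast
  \<comment> \<open>Sending a position in \<open>B\<close> to its successor, which lies in
    \<open>A\<close>, is injective on the positions below \<open>L\<close>.\<close>
  have "card R \<le> card S"
  proof -
    define I where "I = {i. i < L \<and> c i \<in> B}"
    have "R = c ` I"
      unfolding R_def I_def
    proof safe
      fix i assume "c i \<in> B"
      moreover have "c i = c (i mod L)" using eq by simp
      ultimately show "c i \<in> c ` {i. i < L \<and> c i \<in> B}" using L by auto
    qed auto
    then have "card R \<le> card I" by (simp add: I_def card_image_le)
    also have "card I = card ((\<lambda>i. c (Suc i)) ` I)"
    proof (rule card_image[symmetric], rule inj_onI)
      fix i j assume ij: "i \<in> I" "j \<in> I" and "c (Suc i) = c (Suc j)"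
      then have "Suc i mod L = Suc j mod L" using eq by simp
      then show "i = j" using ij by (auto simp: I_def mod_Suc split: if_splits)
    qed
    also have "\<dots> \<le> card S"
    proof (rule card_mono[OF finS])
      show "(\<lambda>i. c (Suc i)) ` I \<subseteq> S"
        using arc bip unfolding I_def S_def by blast
    qed
    finally show ?thesis .
  qed
  \<comment> \<open>The two neighbours are the successor and the predecessor on the cycle, distinct
    because \<open>3 \<le> L\<close>. The predecessor has index \<open>i + (L - 1)\<close>, which
    avoids subtracting from \<open>i\<close>.\<close>
  have nbrs: "\<exists>p q. p \<noteq> q \<and> {p, q} \<subseteq> E `` {v} \<inter> R" if v: "v \<in> S" for v
  proof -
    obtain i where i: "v = c i" and vA: "v \<in> A" using v by (auto simp: S_def)
    let ?p = "c (Suc i)" and ?q = "c (i + (L - 1))"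
    have "c (Suc (i + (L - 1))) = v" using eq[of "i + L" i] i L by simp
    then have "(v, ?q) \<in> E" using arc[of "i + (L - 1)"] sym by (auto dest: symD)
    moreover have "(v, ?p) \<in> E" using arc i by auto
    ultimately have "{?p, ?q} \<subseteq> E `` {v} \<inter> R"
      using EB[OF vA] by (auto simp: R_def)
    moreover have "Suc i + (L - 2) = i + (L - 1)" using L by simp
    then have "?p \<noteq> ?q"
      using eq[of "i + (L - 1)" "Suc i"] mod_add_neq[of "L - 2" L "Suc i"] L by auto
    ultimately show ?thesis by blast
  qed
  have finN: "finite (E `` {v})" if "v \<in> A" for v
    using EB[OF that] fin(2) by (rule finite_subset)
  have two: "card (E `` {v} \<inter> R) \<ge> 2" if v: "v \<in> S" for v
  proof -
    obtain p q where pq: "p \<noteq> q" "{p, q} \<subseteq> E `` {v} \<inter> R" using nbrs[OF v] by blast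
    then have "card {p, q} \<le> card (E `` {v} \<inter> R)" using finR by (intro card_mono) auto
    then show ?thesis using pq(1) by simp
  qed
  have off: "card (E `` {v} - R) + 2 \<le> k" if v: "v \<in> S" for v
  proof -
    have vA: "v \<in> A" using v by (simp add: S_def)
    have "k = card (E `` {v} \<inter> R) + card (E `` {v} - R)"
      using deg[OF vA] card_Int_Diff[OF finN[OF vA]] by simp
    then show ?thesis using two[OF v] by simp
  qed
  \<comment> \<open>Guards the truncated subtraction: it gives \<open>1 + (k - 2) = k - 1\<close> at
    the end of the estimate.\<close>
  have "2 \<le> k" using S_ne off by fastforce
  have "E `` S \<subseteq> R \<union> (\<Union>v\<in>S. E `` {v} - R)" by auto
  moreover have "finite (R \<union> (\<Union>v\<in>S. E `` {v} - R))"
    using finR finS EB fin by (auto simp: S_def intro: finite_subset)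
  ultimately have "card (E `` S) \<le> card (R \<union> (\<Union>v\<in>S. E `` {v} - R))"
    by (intro card_mono)
  also have "\<dots> \<le> card R + card (\<Union>v\<in>S. E `` {v} - R)" by (rule card_Un_le)
  also have "\<dots> \<le> card R + (\<Sum>v\<in>S. card (E `` {v} - R))"
    by (intro add_left_mono card_UN_le finS)
  also have "\<dots> \<le> card S + (\<Sum>v\<in>S. k - 2)"
    using \<open>card R \<le> card S\<close> off by (intro add_mono sum_mono add_le_imp_le_diff)
  also have "\<dots> = (1 + (k - 2)) * card S" by simp
  also have "\<dots> = (k - 1) * card S" using \<open>2 \<le> k\<close> by (intro arg_cong2[where f = "(*)"]) auto
  also have "\<dots> < card (E `` S)"
    using exp[of S] S_ne by (auto simp: S_def)
  finally show False by simp
qed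

text \<open>
  Tight sets through a fixed vertex are closed under intersection by submodularity of
  \<open>\<lambda>S. card (F `` S)\<close>. By minimality of \<open>F\<close> every neighbour \<open>b\<close> of \<open>v\<close> misses \<open>S - {v}\<close> for
  some tight \<open>S\<close> through \<open>v\<close>, hence all neighbours of \<open>v\<close> miss \<open>X - {v}\<close> for the least tight
  \<open>X\<close>, which forces \<open>v\<close> to have degree \<open>q + 1\<close>.
\<close>

lemma minimal_expanding_degree:
  fixes F :: "('a \<times> 'b) set"
  assumes F: "F \<subseteq> A \<times> B" and fin: "finite A" "finite B"
    and exp: "\<And>S. S \<subseteq> A \<Longrightarrow> S \<noteq> {} \<Longrightarrow> q * card S < card (F `` S)"
    and minimal: "\<And>e. e \<in> F \<Longrightarrow> \<exists>S\<subseteq>A. S \<noteq> {} \<and> card ((F - {e}) `` S) \<le> q * card S"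
    and v: "v \<in> A"
  shows "card (F `` {v}) = q + 1"
proof -
  define tight where "tight S \<longleftrightarrow> S \<subseteq> A \<and> v \<in> S \<and> card (F `` S) = q * card S + 1" for S
  have finF: "finite (F `` S)" for S using F fin by (auto intro: finite_subset[of _ B])
  have finS: "finite S" if "S \<subseteq> A" for S using that fin by (auto intro: finite_subset)
  have tight_Int: "tight (S \<inter> T)" if "tight S" "tight T" for S T
  proof -
    have ST: "S \<subseteq> A" "T \<subseteq> A" "v \<in> S \<inter> T" using that by (auto simp: tight_def)
    \<comment> \<open>Submodularity: the image of the union is the union of the images, while the
      image of the intersection only lies in the intersection of the images.\<close>
    have "card (F `` (S \<inter> T)) + card (F `` (S \<union> T)) \<le> card (F `` S \<inter> F `` T) + card (F `` S \<union> F `` T)"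
      using finF by (intro add_mono card_mono) auto
    also have "\<dots> = card (F `` S) + card (F `` T)"
      using card_Un_Int[of "F `` S" "F `` T"] finF by simp
    also have "\<dots> = q * (card S + card T) + 2"
      using that by (simp add: tight_def algebra_simps)
    also have "card S + card T = card (S \<inter> T) + card (S \<union> T)"
      using card_Un_Int[of S T] finS ST by simp
    finally have "card (F `` (S \<inter> T)) + card (F `` (S \<union> T)) \<le> q * card (S \<inter> T) + q * card (S \<union> T) + 2"
      by (simp add: algebra_simps)
    \<comment> \<open>The excesses over \<open>q\<close> times the size add up to at most 2, and
      each of the two sets contains \<open>v\<close> and has excess at least 1, so both excesses are
      exactly 1.\<close>
    moreover have "q * card (S \<inter> T) < card (F `` (S \<inter> T))" "q * card (S \<union> T) < card (F `` (S \<union> T))"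
      using ST by (auto intro!: exp)
    ultimately show ?thesis using ST by (auto simp: tight_def)
  qed
  have ex_tight: "\<exists>S. tight S \<and> b \<notin> F `` (S - {v})" if b: "(v, b) \<in> F" for b
  proof -
    obtain S where S: "S \<subseteq> A" "S \<noteq> {}" "card ((F - {(v, b)}) `` S) \<le> q * card S"
      using minimal[OF b] by blast
    have lt: "q * card S < card (F `` S)" using exp S by blast
    have ne: "(F - {(v, b)}) `` S \<noteq> F `` S" using lt S by auto
    \<comment> \<open>Deleting \<open>(v, b)\<close> changes the image of \<open>S\<close> only if
      \<open>v\<close> is in \<open>S\<close> and no other vertex of \<open>S\<close> is joined to
      \<open>b\<close>.\<close>
    then have vb: "v \<in> S" "b \<notin> F `` (S - {v})" by auto
    have "F `` S \<subseteq> insert b ((F - {(v, b)}) `` S)" by auto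
    moreover have "finite ((F - {(v, b)}) `` S)"
      by (rule finite_subset[OF _ finF[of S]]) auto
    ultimately have "card (F `` S) \<le> card (insert b ((F - {(v, b)}) `` S))"
      by (intro card_mono) auto
    also have "\<dots> \<le> card ((F - {(v, b)}) `` S) + 1"
      by (rule card_insert_le_m1) simp_all
    finally have "tight S" using S lt vb by (simp add: tight_def)
    with vb show ?thesis by blast
  qed
  have "F `` {v} \<noteq> {}"
    using exp[of "{v}"] v by auto
  then obtain S0 where "tight S0" using ex_tight by blast
  then obtain X where X: "tight X" and least: "\<And>S. tight S \<Longrightarrow> card X \<le> card S"
    using ex_has_least_nat[of tight S0 card] by auto
  have XA: "X \<subseteq> A" "v \<in> X" "card (F `` X) = q * card X + 1" using X by (auto simp: tight_def)
  have X_sub: "X \<subseteq> S" if "tight S" for S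
  proof -
    have "card X \<le> card (X \<inter> S)" using least tight_Int[OF X that] by simp
    then have "X \<inter> S = X" using finS[OF XA(1)] by (intro card_seteq) auto
    then show ?thesis by auto
  qed
  have disj: "F `` {v} \<inter> F `` (X - {v}) = {}"
    using ex_tight X_sub by blast
  have split: "F `` X = F `` {v} \<union> F `` (X - {v})" using XA by auto
  have cX: "card (F `` X) = card (F `` {v}) + card (F `` (X - {v}))"
    unfolding split by (rule card_Un_disjoint[OF finF finF disj])
  have lb: "q < card (F `` {v})" using exp[of "{v}"] v by simp
  show ?thesis
  proof (cases "X - {v} = {}")
    case True
    then have "X = {v}" using XA by auto
    then show ?thesis using XA(3) by simp
  next
    case False
    \<comment> \<open>This case is impossible: the image of \<open>X - {v}\<close> has more than
      \<open>q * (card X - 1)\<close> elements, which leaves at most \<open>q\<close> of the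
      \<open>q * card X + 1\<close> elements of the image of \<open>X\<close> for the neighbours of
      \<open>v\<close>, against \<open>lb\<close>.\<close>
    have "q * card (X - {v}) < card (F `` (X - {v}))" using XA False by (intro exp) auto
    moreover have "card X = card (X - {v}) + 1"
      using XA finS[OF XA(1)] by (metis Suc_eq_plus1 card_Suc_Diff1)
    ultimately show ?thesis using cX XA(3) lb by (simp add: algebra_simps)
  qed
qed

section \<open>Extension of a minimal expanding arc set to a spanning tree\<close>

lemma minimal_subset_exists:
  assumes "finite U" "P U"
  obtains F where "F \<subseteq> U" "P F" "\<And>F'. F' \<subset> F \<Longrightarrow> \<not> P F'"
proof -
  have "finite {F. F \<subseteq> U \<and> P F}" "{F. F \<subseteq> U \<and> P F} \<noteq> {}" using assms by auto
  from finite_has_minimal[OF this] obtain F where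
    "F \<in> {F. F \<subseteq> U \<and> P F}" "\<forall>F'\<in>{F. F \<subseteq> U \<and> P F}. F' \<subseteq> F \<longrightarrow> F = F'"
    by blast
  then show thesis by (intro that[of F]) auto
qed

text \<open>A minimal expanding set \<open>F\<close> of arcs from \<open>A\<close> to
  \<open>B\<close> gives every vertex of \<open>A\<close> degree \<open>k\<close>, and its
  symmetrisation \<open>D\<close> has no cycle. A minimal symmetric arc set \<open>X\<close> that
  contains \<open>D\<close> and has the same reachability as \<open>G\<close> is then acyclic too: a
  cycle would have an arc outside \<open>D\<close>, and that edge could be deleted.\<close>

lemma spanning_tree_if_expanding:
  assumes G: "pair_graph G" and conn: "Digraph_Component.connected (with_proj G)"
    and bip: "bipartition G A B"
    and exp: "\<And>S. S \<subseteq> A \<Longrightarrow> S \<noteq> {} \<Longrightarrow> (k - 1) * card S < card (parcs G `` S)" and "k \<ge> 1"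
  shows "\<exists>T. undirected_spanning_tree T G \<and> (\<forall>v\<in>A. degree_of T v \<ge> k)"
proof -
  interpret pair_graph G by fact
  have AB: "pverts G = A \<union> B" "A \<inter> B = {}" and EAB: "parcs G \<subseteq> A \<times> B \<union> B \<times> A"
    using bip by (auto simp: bipartition_def)
  have fin: "finite A" "finite B" using AB pair_finite_verts by auto
  have symE: "sym (parcs G)" using arcs_symmetric by (auto simp: sym_def)
  define E where "E = parcs G \<inter> A \<times> B"
  define P where "P F \<longleftrightarrow> (\<forall>S\<subseteq>A. S \<noteq> {} \<longrightarrow> (k - 1) * card S < card (F `` S))" for F :: "'a rel"
  have "E `` S = parcs G `` S" if "S \<subseteq> A" for S
    using that EAB AB(2) unfolding E_def by blast
  then have "P E" using exp by (auto simp: P_def)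
  moreover have "finite E" using pair_finite_arcs by (simp add: E_def)
  ultimately obtain F where F: "F \<subseteq> E" "P F" and F_min: "\<And>F'. F' \<subset> F \<Longrightarrow> \<not> P F'"
    using minimal_subset_exists[of E P] by blast
  have FAB: "F \<subseteq> A \<times> B" using F by (auto simp: E_def)
  have degF: "card (F `` {v}) = k" if "v \<in> A" for v
  proof -
    have "card (F `` {v}) = (k - 1) + 1"
    proof (rule minimal_expanding_degree[OF FAB fin _ _ that])
      fix e assume "e \<in> F"
      then have "\<not> P (F - {e})" by (intro F_min) auto
      then show "\<exists>S\<subseteq>A. S \<noteq> {} \<and> card ((F - {e}) `` S) \<le> (k - 1) * card S"
        by (auto simp: P_def not_less)
    qed (use F in \<open>auto simp: P_def\<close>)
    then show ?thesis using \<open>k \<ge> 1\<close> by simp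
  qed
  define D where "D = F \<union> F\<inverse>"
  have D_Image: "D `` S = F `` S" if "S \<subseteq> A" for S
    using that FAB AB by (auto simp: D_def)
  have symD: "sym D" by (auto simp: D_def sym_def)
  have D_sub: "D \<subseteq> parcs G" using F symE by (auto simp: D_def E_def sym_def)
  define Q where "Q X \<longleftrightarrow> D \<subseteq> X \<and> sym X \<and> X\<^sup>* = (parcs G)\<^sup>*" for X
  have "Q (parcs G)" using D_sub symE by (simp add: Q_def)
  then obtain X where X: "X \<subseteq> parcs G" "Q X" and X_min: "\<And>X'. X' \<subset> X \<Longrightarrow> \<not> Q X'"
    using minimal_subset_exists[of "parcs G" Q] pair_finite_arcs by blast
  define T where "T = \<lparr>pverts = pverts G, parcs = X\<rparr>"
  have T: "pair_graph T"
  proof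
    show "symmetric (with_proj T)" using X by (auto simp: Q_def T_def symmetric_def)
  qed (use X wellformed' pair_finite_verts pair_no_loops in
        \<open>auto simp: T_def intro: finite_subset[OF _ pair_finite_arcs]\<close>)
  then interpret T: pair_graph T .
  have "Digraph_Component.connected (with_proj T)"
    using conn X unfolding connected_iff_rtrancl T.connected_iff_rtrancl
    by (simp add: T_def Q_def)
  moreover have "\<not> pre_digraph.cycle (with_proj T) p" if L: "3 \<le> length p" for p
  proof
    assume "pre_digraph.cycle (with_proj T) p"
    then obtain c where c: "cyclic_sequence X (length p) c"
      by (auto elim: cycle_imp_cyclic_sequence simp: T_def)
    have "\<not> cyclic_sequence D (length p) c"
    proof (rule no_cyclic_sequence_if_expanding[OF symD _ AB(2) fin _ _ L])
      show "D \<subseteq> A \<times> B \<union> B \<times> A" using FAB by (auto simp: D_def)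
      show "card (D `` {v}) = k" if "v \<in> A" for v
        using D_Image[of "{v}"] that degF by simp
      show "(k - 1) * card S < card (D `` S)" if "S \<subseteq> A" "S \<noteq> {}" for S
        using D_Image that F by (simp add: P_def)
    qed
    then obtain j where j: "(c j, c (Suc j)) \<notin> D"
      using c by (auto simp: cyclic_sequence_def)
    let ?X = "X - {(c j, c (Suc j)), (c (Suc j), c j)}"
    have symX: "sym X" using X by (simp add: Q_def)
    have "?X\<^sup>* = X\<^sup>*" by (rule rtrancl_remove_cycle_edge[OF symX c L])
    moreover have "sym ?X" using symX by (auto simp: sym_def)
    moreover have "D \<subseteq> ?X" using j symD X by (auto simp: Q_def sym_def)
    ultimately have "Q ?X" using X by (simp add: Q_def)
    moreover have "?X \<subset> X" using c by (auto simp: cyclic_sequence_def)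
    ultimately show False using X_min by blast
  qed
  ultimately have "undirected_tree T" using T by (auto simp: undirected_tree_def)
  moreover have "spanning (with_proj T) (with_proj G)"
    using X wf_digraph T.wf_digraph
    by (simp add: spanning_def subgraph_def compatible_def) (simp add: T_def)
  moreover have "k \<le> degree_of T v" if "v \<in> A" for v
  proof -
    have "k = card (F `` {v})" using degF that by simp
    also have "\<dots> \<le> card (parcs T `` {v})"
    proof (rule card_mono)
      show "finite (parcs T `` {v})" using T.pair_finite_arcs by (rule finite_Image)
      show "F `` {v} \<subseteq> parcs T `` {v}" using X by (auto simp: T_def Q_def D_def)
    qed
    finally show ?thesis by (simp add: T.degree_of_eq_card_Image)
  qed
  ultimately show ?thesis by (auto simp: undirected_spanning_tree_def)
qed

section \<open>The signless Laplacian spectral radius\<close>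

definition signless_apply :: "'a pair_pre_digraph \<Rightarrow> ('a \<Rightarrow> real) \<Rightarrow> 'a \<Rightarrow> real" where
  "signless_apply G x u = real (card (parcs G `` {u})) * x u + (\<Sum>w\<in>parcs G `` {u}. x w)"

lemma (in pair_fin_digraph) signless_laplacian_mult_vec:
  assumes vs: "distinct vs" "set vs = pverts G" and i: "i < length vs"
  shows "(signless_laplacian G vs *\<^sub>v vec (length vs) (\<lambda>j. x (vs ! j))) $ i
    = signless_apply G x (vs ! i)"
proof -
  let ?n = "length vs" and ?u = "vs ! i"
  have "(signless_laplacian G vs *\<^sub>v vec ?n (\<lambda>j. x (vs ! j))) $ i =
    (\<Sum>j<?n. ((if i = j then real (degree_of G ?u) else 0) +
      (if (?u, vs ! j) \<in> parcs G then 1 else 0)) * x (vs ! j))"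
    using i by (simp add: signless_laplacian_def degree_matrix_def adjacency_matrix_def
        scalar_prod_def lessThan_atLeast0)
  also have "\<dots> = (\<Sum>j<?n. (if i = j then real (degree_of G ?u) * x (vs ! j) else 0)) +
      (\<Sum>j<?n. if (?u, vs ! j) \<in> parcs G then x (vs ! j) else 0)"
    by (subst sum.distrib[symmetric]) (intro sum.cong, auto simp: algebra_simps)
  also have "(\<Sum>j<?n. (if i = j then real (degree_of G ?u) * x (vs ! j) else 0))
      = real (degree_of G ?u) * x ?u"
    using i by simp
  also have "(\<Sum>j<?n. if (?u, vs ! j) \<in> parcs G then x (vs ! j) else 0)
      = (\<Sum>w\<in>pverts G. if (?u, w) \<in> parcs G then x w else 0)"
    using sum.reindex_bij_betw[OF bij_betw_nth[OF vs(1) refl vs(2)[symmetric]]] by fast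
  also have "\<dots> = (\<Sum>w\<in>parcs G `` {?u}. x w)"
    using pair_finite_verts in_arcsD2 by (intro sum.mono_neutral_cong_right) auto
  finally show ?thesis
    by (simp add: signless_apply_def degree_of_eq_card_Image)
qed

text \<open>Vectors indexed by positions in \<open>vs\<close> correspond to functions on the
  vertices, and in terms of the latter the enumeration disappears.\<close>

lemma (in pair_fin_digraph) mem_spectrum_signless_laplacian_iff:
  assumes vs: "distinct vs" "set vs = pverts G"
  shows "l \<in> spectrum (signless_laplacian G vs) \<longleftrightarrow>
    (\<exists>x. (\<exists>u\<in>pverts G. x u \<noteq> 0) \<and> (\<forall>u\<in>pverts G. signless_apply G x u = l * x u))"
    (is "?L \<longleftrightarrow> ?R")
proof -
  let ?n = "length vs" and ?M = "signless_laplacian G vs"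
  have dim: "dim_row ?M = ?n" by (simp add: signless_laplacian_def adjacency_matrix_def)
  have *: "eigenvector ?M (vec ?n (\<lambda>j. x (vs ! j))) l \<longleftrightarrow>
      (\<exists>u\<in>pverts G. x u \<noteq> 0) \<and> (\<forall>u\<in>pverts G. signless_apply G x u = l * x u)" for x
  proof -
    have all: "(\<forall>u\<in>pverts G. P u) \<longleftrightarrow> (\<forall>i<?n. P (vs ! i))" for P
      unfolding vs(2)[symmetric] by (rule all_set_conv_all_nth)
    have ex: "(\<exists>u\<in>pverts G. x u \<noteq> 0) \<longleftrightarrow> \<not> (\<forall>i<?n. x (vs ! i) = 0)"
      using all[of "\<lambda>u. x u = 0"] by blast
    show ?thesis
      using signless_laplacian_mult_vec[OF vs, of _ x] unfolding all ex
      by (simp add: eigenvector_def dim vec_eq_iff del: index_mult_mat_vec)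
  qed
  show ?thesis
  proof
    assume ?L
    then obtain v where v: "eigenvector ?M v l" by (auto simp: spectrum_def eigenvalue_def)
    define x where "x u = v $ the_inv_into {..<?n} ((!) vs) u" for u
    have "x (vs ! j) = v $ j" if "j < ?n" for j
      using that inj_on_nth[OF vs(1), of "{..<?n}"] by (simp add: x_def the_inv_into_f_f)
    then have "v = vec ?n (\<lambda>j. x (vs ! j))"
      using v by (auto simp: eigenvector_def dim)
    then show ?R using v * by metis
  next
    assume ?R
    then show ?L using * by (auto simp: spectrum_def eigenvalue_def)
  qed
qed

text \<open>Gives access to the enumeration chosen by \<open>SOME\<close> through its properties,
  together with the finiteness that reasoning about \<open>Max\<close> requires.\<close>

lemma (in pair_fin_digraph) signless_spectral_radius_Max:
  obtains vs where "distinct vs" "set vs = pverts G"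
    "signless_spectral_radius G = Max (spectrum (signless_laplacian G vs))"
    "finite (spectrum (signless_laplacian G vs))"
proof -
  let ?vs = "SOME vs. distinct vs \<and> set vs = pverts G"
  obtain us where "set us = pverts G" "distinct us"
    using finite_distinct_list[OF pair_finite_verts] by blast
  then have "distinct ?vs \<and> set ?vs = pverts G"
    by (intro someI[of "\<lambda>vs. distinct vs \<and> set vs = pverts G" us] conjI)
  moreover have "signless_laplacian G ?vs \<in> carrier_mat (length ?vs) (length ?vs)"
    by (simp add: signless_laplacian_def degree_matrix_def adjacency_matrix_def)
  then have "finite (spectrum (signless_laplacian G ?vs))"
    by (rule card_finite_spectrum)
  ultimately show thesis using that[of ?vs] by (simp add: signless_spectral_radius_def)
qed

lemma (in pair_fin_digraph) signless_spectral_radius_ge: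
  assumes "u \<in> pverts G" "x u \<noteq> 0" "\<And>u. u \<in> pverts G \<Longrightarrow> signless_apply G x u = l * x u"
  shows "l \<le> signless_spectral_radius G"
proof -
  obtain vs where vs: "distinct vs" "set vs = pverts G"
    "signless_spectral_radius G = Max (spectrum (signless_laplacian G vs))"
    "finite (spectrum (signless_laplacian G vs))"
    by (rule signless_spectral_radius_Max)
  have "l \<in> spectrum (signless_laplacian G vs)"
    unfolding mem_spectrum_signless_laplacian_iff[OF vs(1,2)] using assms by blast
  then show ?thesis using vs by simp
qed

text \<open>
  The maximum in the definition is taken over a nonempty set because a bipartite graph has the
  eigenvalue 0: the vector that is \<open>1\<close> on \<open>A\<close> and \<open>- 1\<close> on \<open>B\<close> lies in the kernel.
\<close>

lemma signless_spectral_radius_eigenvector: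
  assumes "pair_fin_digraph G" and bip: "bipartition G A B" and ne: "pverts G \<noteq> {}"
  shows "\<exists>x. (\<exists>u\<in>pverts G. x u \<noteq> 0) \<and>
    (\<forall>u\<in>pverts G. signless_apply G x u = signless_spectral_radius G * x u)"
proof -
  interpret pair_fin_digraph G by fact
  obtain vs where vs: "distinct vs" "set vs = pverts G"
    "signless_spectral_radius G = Max (spectrum (signless_laplacian G vs))"
    "finite (spectrum (signless_laplacian G vs))"
    by (rule signless_spectral_radius_Max)
  define x where "x u = (if u \<in> A then 1 else - 1 :: real)" for u
  have "signless_apply G x u = 0" if "u \<in> pverts G" for u
  proof -
    have "x w = - x u" if "w \<in> parcs G `` {u}" for w
      using that bip by (auto simp: bipartition_def x_def)
    then show ?thesis by (simp add: signless_apply_def)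
  qed
  moreover have "x u \<noteq> 0" for u by (simp add: x_def)
  ultimately have "(\<exists>u\<in>pverts G. x u \<noteq> 0) \<and> (\<forall>u\<in>pverts G. signless_apply G x u = 0 * x u)"
    using ne by auto
  then have "0 \<in> spectrum (signless_laplacian G vs)"
    unfolding mem_spectrum_signless_laplacian_iff[OF vs(1,2)] by (rule exI[of _ x])
  then have "signless_spectral_radius G \<in> spectrum (signless_laplacian G vs)"
    using vs(3,4) by (metis Max_in empty_iff)
  then show ?thesis
    unfolding mem_spectrum_signless_laplacian_iff[OF vs(1,2)] .
qed

text \<open>
  Compare an eigenvector \<open>x\<close> of \<open>G\<close> with the pullback of \<open>v\<close>. Where \<open>\<bar>x\<bar> / v\<close> is maximal all
  estimates are equalities, so it is also maximal at the neighbours, hence everywhere.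
\<close>

lemma signless_embedding_rigid:
  fixes \<phi> :: "'a \<Rightarrow> 'b" and v :: "'b \<Rightarrow> real"
  assumes G: "pair_graph G" and H: "pair_fin_digraph H"
    and conn: "Digraph_Component.connected (with_proj G)"
    and inj: "inj_on \<phi> (pverts G)" and verts: "\<phi> ` pverts G \<subseteq> pverts H"
    and arcs: "\<And>a b. (a, b) \<in> parcs G \<Longrightarrow> (\<phi> a, \<phi> b) \<in> parcs H"
    and pos: "\<And>y. y \<in> pverts H \<Longrightarrow> v y > 0"
    and super: "\<And>y. y \<in> pverts H \<Longrightarrow> signless_apply H v y \<le> l * v y"
    and x: "\<And>u. u \<in> pverts G \<Longrightarrow> signless_apply G x u = l' * x u"
    and nz: "a \<in> pverts G" "x a \<noteq> 0" and le: "l \<le> l'"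
  shows "l' = l" and "\<And>u. u \<in> pverts G \<Longrightarrow> parcs H `` {\<phi> u} = \<phi> ` (parcs G `` {u})"
proof -
  interpret G: pair_graph G by fact
  interpret H: pair_fin_digraph H by fact
  define r where "r u = \<bar>x u\<bar> / v (\<phi> u)" for u
  have vpos: "v (\<phi> u) > 0" if "u \<in> pverts G" for u using that verts pos by auto
  define r0 where "r0 = Max (r ` pverts G)"
  have r_le: "r u \<le> r0" if "u \<in> pverts G" for u
    using that G.pair_finite_verts by (simp add: r0_def)
  have "r a > 0" using nz vpos by (simp add: r_def)
  then have r0: "r0 > 0" using r_le[OF nz(1)] by simp
  have x_le: "\<bar>x u\<bar> \<le> r0 * v (\<phi> u)" if "u \<in> pverts G" for u
    using r_le[OF that] vpos[OF that] by (simp add: r_def divide_le_eq)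
  have step: "l' = l \<and> parcs H `` {\<phi> u} = \<phi> ` (parcs G `` {u}) \<and> (\<forall>w\<in>parcs G `` {u}. r w = r0)"
    if u: "u \<in> pverts G" and ru: "r u = r0" for u
  proof -
    let ?N = "parcs G `` {u}" and ?M = "parcs H `` {\<phi> u}"
    have N: "?N \<subseteq> pverts G" using G.in_arcsD2 by auto
    have finN: "finite ?N" using N G.pair_finite_verts by (rule finite_subset)
    have M: "?M \<subseteq> pverts H" using H.in_arcsD2 by auto
    have finM: "finite ?M" using M H.pair_finite_verts by (rule finite_subset)
    have NM: "\<phi> ` ?N \<subseteq> ?M" using arcs by auto
    have injN: "inj_on \<phi> ?N" using inj N by (rule inj_on_subset)
    have xu: "\<bar>x u\<bar> = r0 * v (\<phi> u)" using ru vpos[OF u] by (auto simp: r_def)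
    have card_le: "real (card ?N) \<le> real (card ?M)"
      using card_mono[OF finM NM] by (simp add: card_image[OF injN])
    have "l' * \<bar>x u\<bar> \<le> \<bar>l' * x u\<bar>" by (simp add: abs_mult mult_right_mono)
    also have "\<dots> \<le> \<bar>real (card ?N) * x u\<bar> + \<bar>\<Sum>w\<in>?N. x w\<bar>"
      unfolding x[OF u, symmetric] signless_apply_def by (rule abs_triangle_ineq)
    also have "\<dots> \<le> real (card ?N) * \<bar>x u\<bar> + (\<Sum>w\<in>?N. \<bar>x w\<bar>)"
      by (simp add: abs_mult)
    finally have 1: "l' * \<bar>x u\<bar> \<le> real (card ?N) * \<bar>x u\<bar> + (\<Sum>w\<in>?N. \<bar>x w\<bar>)" .
    have 2: "(\<Sum>w\<in>?N. \<bar>x w\<bar>) \<le> (\<Sum>w\<in>?N. r0 * v (\<phi> w))"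
      using N x_le by (intro sum_mono) auto
    have 3: "(\<Sum>w\<in>?N. r0 * v (\<phi> w)) = r0 * (\<Sum>y\<in>\<phi> ` ?N. v y)"
      by (simp add: sum.reindex[OF injN] sum_distrib_left)
    have 4: "(\<Sum>y\<in>\<phi> ` ?N. v y) \<le> (\<Sum>y\<in>?M. v y)"
      using pos M by (intro sum_mono2[OF finM NM]) (auto intro: less_imp_le)
    have 5: "real (card ?N) * v (\<phi> u) \<le> real (card ?M) * v (\<phi> u)"
      using card_le vpos[OF u] by (intro mult_right_mono) auto
    have 6: "real (card ?M) * v (\<phi> u) + (\<Sum>y\<in>?M. v y) \<le> l * v (\<phi> u)"
      using super[of "\<phi> u"] u verts by (auto simp: signless_apply_def)
    have 7: "l * v (\<phi> u) \<le> l' * v (\<phi> u)"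
      using le vpos[OF u] by (intro mult_right_mono) auto
    define p where "p = (\<Sum>y\<in>\<phi> ` ?N. v y)"
    have "r0 * (real (card ?N) * v (\<phi> u) + (\<Sum>w\<in>?N. \<bar>x w\<bar>) / r0) \<ge> r0 * (l' * v (\<phi> u))"
      using 1 r0 by (simp add: xu algebra_simps)
    then have 8: "real (card ?N) * v (\<phi> u) + (\<Sum>w\<in>?N. \<bar>x w\<bar>) / r0 \<ge> l' * v (\<phi> u)"
      using r0 by simp
    have 9: "(\<Sum>w\<in>?N. \<bar>x w\<bar>) / r0 \<le> p"
      using 2 r0 unfolding 3 p_def by (simp add: divide_le_eq mult.commute)
    \<comment> \<open>These inequalities form a closed chain from \<open>l' * v (\<phi> u)\<close>
      through the sums over \<open>?N\<close> and over \<open>?M\<close> back to itself, so each of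
      them is an equality.\<close>
    note ineqs = 8 9 4[folded p_def] 5 6 7
    have "(\<Sum>w\<in>?N. \<bar>x w\<bar>) / r0 = p" using ineqs by linarith
    then have "(\<Sum>w\<in>?N. \<bar>x w\<bar>) = (\<Sum>w\<in>?N. r0 * v (\<phi> w))"
      using r0 unfolding 3 p_def by (simp add: field_simps)
    then have "\<forall>w\<in>?N. \<bar>x w\<bar> = r0 * v (\<phi> w)"
      using sum_mono_inv[of "\<lambda>w. \<bar>x w\<bar>" ?N "\<lambda>w. r0 * v (\<phi> w)"] x_le N finN by blast
    then have "\<forall>w\<in>?N. r w = r0" using N vpos[THEN less_imp_neq] by (auto simp: r_def)
    moreover have "l' * v (\<phi> u) = l * v (\<phi> u)" using ineqs by linarith
    then have "l' = l" using vpos[OF u] by simp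
    \<comment> \<open>Neighbours of \<open>\<phi> u\<close> outside the image of \<open>?N\<close>
      would have total weight 0; since \<open>v\<close> is positive, there are none.\<close>
    moreover have "p = (\<Sum>y\<in>?M. v y)" using ineqs by linarith
    then have "(\<Sum>y\<in>?M - \<phi> ` ?N. v y) = 0"
      using sum.subset_diff[OF NM finM, of v] by (simp add: p_def)
    then have "?M - \<phi> ` ?N = {}"
      using sum_pos[of "?M - \<phi> ` ?N" v] finM pos M by fastforce
    ultimately show ?thesis using NM by auto
  qed
  have "r0 \<in> r ` pverts G"
    unfolding r0_def using nz(1) G.pair_finite_verts by (intro Max_in) auto
  then obtain b where b: "b \<in> pverts G" "r b = r0" by auto
  have all: "r u = r0" if "u \<in> pverts G" for u
  proof -
    have "(b, u) \<in> (parcs G)\<^sup>*" using conn b that by (simp add: G.connected_iff_rtrancl)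
    then have "u \<in> pverts G \<and> r u = r0"
    proof induction
      case (step y z)
      then show ?case using \<open>\<And>u. u \<in> pverts G \<Longrightarrow> r u = r0 \<Longrightarrow> _\<close> G.in_arcsD2 by blast
    qed (use b in simp)
    then show ?thesis by simp
  qed
  show "l' = l" using step b by blast
  show "parcs H `` {\<phi> u} = \<phi> ` (parcs G `` {u})" if "u \<in> pverts G" for u
    using step[OF that all[OF that]] by blast
qed

section \<open>The graphs \<open>K\<^bsub>s,b\<^esub> \<nabla> K\<^bsub>m-s,n-b\<^esub>\<close>\<close>

text \<open>
  Here \<open>N = n - 1\<close>, and the weights are those for which the first, third and fourth inequality are
  equalities when \<open>b m = s N\<close>, the largest \<open>b\<close> allowed by the hypotheses. The second inequality
  reduces to that case because its left-hand side increases with \<open>b\<close>, as \<open>w \<le> z\<close>.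
\<close>

lemma template_supersolution:
  fixes s m N b :: real
  assumes s: "2 \<le> s" "s \<le> m - 1" and N: "2 * m \<le> N" and b: "0 \<le> b" "b * m \<le> s * N"
  shows "\<exists>x y z w. 0 < x \<and> 0 < y \<and> 0 < z \<and> 0 < w \<and>
    b * (x + z) \<le> (m + N) * x \<and> (N + 1) * y + b * z + (N + 1 - b) * w \<le> (m + N) * y \<and>
    m * z + s * x + (m - s) * y \<le> (m + N) * z \<and> (m - s) * (w + y) \<le> (m + N) * w"
proof -
  define c where "c = m - s"
  define p where "p = m + s + N"
  define x where "x = s / p"
  define z where "z = (m\<^sup>2 + N * c) / (N * p)"
  define w where "w = c / (N + s)"
  have m: "m \<ge> 3" and c: "c \<ge> 1" and mc: "m = c + s" using s by (auto simp: c_def)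
  have Npos: "N > 0" and p: "p > 0" using N m s by (auto simp: p_def)
  have ms: "m * s \<ge> 6" using mult_mono[of 3 m 2 s] m s by simp
  have pos: "x > 0" "z > 0" "w > 0"
    using s p Npos c by (auto simp: x_def z_def w_def intro!: divide_pos_pos add_nonneg_pos add_pos_pos)
  have "b \<le> s * N / m" using b m by (simp add: pos_le_divide_eq)
  have 1: "b * (x + z) \<le> (m + N) * x"
  proof -
    have "b * (x + z) \<le> s * N / m * (x + z)"
      using \<open>b \<le> s * N / m\<close> pos by (intro mult_right_mono) auto
    also have "\<dots> = (m + N) * x"
    proof -
      have "N * (x + z) = N * s / p + (m\<^sup>2 + N * c) / p"
        using Npos p by (simp add: x_def z_def field_simps)
      also have "\<dots> = m * (m + N) / p"
        using p by (simp add: mc power2_eq_square field_simps)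
      finally have "s / m * (N * (x + z)) = s / m * (m * (m + N) / p)" by (rule arg_cong)
      then have "s * N / m * (x + z) = s / m * (m * (m + N) / p)" by (simp only: times_divide_eq_left mult.assoc)
      also have "\<dots> = (m + N) * x" using m by (simp add: x_def)
      finally show ?thesis .
    qed
    finally show ?thesis .
  qed
  \<comment> \<open>With \<open>y = 1\<close>, \<open>Nz\<close> is the third inequality read as an
    equality after cancelling \<open>m * z\<close>, and the next fact is likewise the fourth, since
    \<open>m - c = s\<close>.\<close>
  have Nz: "N * z = c + s * x"
    using Npos p by (simp add: z_def x_def field_simps) (simp add: p_def mc power2_eq_square algebra_simps)
  have w: "(N + s) * w = c" using Npos s by (simp add: w_def)
  have "w \<le> c / N" using Npos s c unfolding w_def by (intro divide_left_mono) auto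
  also have "\<dots> \<le> z" using Nz Npos s pos by (simp add: divide_le_eq mult.commute)
  finally have wz: "w \<le> z" .
  \<comment> \<open>The second inequality with \<open>y = 1\<close>. After multiplying by
    \<open>m\<close> and replacing \<open>b\<close> by \<open>s * N / m\<close>, the two identities
    turn the left-hand side into \<open>m * c\<close> plus terms bounded by \<open>m * s / 3\<close>
    and \<open>1 / 2\<close>.\<close>
  have 2: "b * z + (N + 1 - b) * w \<le> m - 1"
  proof -
    have "b * (z - w) \<le> s * N / m * (z - w)"
      using \<open>b \<le> s * N / m\<close> wz by (intro mult_right_mono) auto
    then have "m * (b * z + (N + 1 - b) * w) \<le> m * (s * N / m * (z - w) + (N + 1) * w)"
      using m by (intro mult_left_mono) (auto simp: algebra_simps)
    also have "\<dots> = s * (N * z) + (N * c + m) * w"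
      using m by (simp add: field_simps) (simp add: mc algebra_simps)
    also have "s * (N * z) = s * c + s * (s * x)" by (simp add: Nz algebra_simps)
    also have "(N * c + m) * w = c * c + (m - c * s) * w"
      using w by (simp add: algebra_simps flip: w)
    also have "s * c + s * (s * x) + (c * c + (m - c * s) * w) = m * c + s * (s * x) + (m - c * s) * w"
      by (simp add: mc algebra_simps)
    also have "(m - c * s) * w \<le> 1 * w"
    proof (intro mult_right_mono)
      have "(s - 1) * (c - 1) \<ge> 0" using s c by (intro mult_nonneg_nonneg) auto
      then show "m - c * s \<le> 1" by (simp add: mc algebra_simps)
    qed (use pos in simp)
    also have "1 * w \<le> 1 / 2" using N s Npos by (simp add: w_def mc field_simps)
    also have "s * (s * x) \<le> s * (m / 3)"
    proof (intro mult_left_mono)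
      have "s * s \<le> m / 3 * (3 * m)" using mult_mono[of s m s m] s by simp
      also have "\<dots> \<le> m / 3 * p" using N s m by (intro mult_left_mono) (auto simp: p_def)
      finally show "s * x \<le> m / 3" using p by (simp add: x_def field_simps)
    qed (use s in simp)
    also have "m * c + s * (m / 3) + 1 / 2 \<le> m * (m - 1)"
    proof -
      have "m * s \<ge> 2 * m" using s m by (simp add: mult.commute)
      moreover have "m * c = m * m - m * s" "m * (m - 1) = m * m - m" "s * (m / 3) = m * s / 3"
        by (simp_all add: c_def algebra_simps)
      ultimately show ?thesis using m by linarith
    qed
    finally show ?thesis using m by simp
  qed
  show ?thesis
  proof (rule exI[of _ x], rule exI[of _ 1], rule exI[of _ z], rule exI[of _ w], intro conjI)
    show "0 < x" "0 < z" "0 < w" by (fact pos)+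
    show "(0::real) < 1" by simp
    show "b * (x + z) \<le> (m + N) * x" by (fact 1)
    show "(N + 1) * 1 + b * z + (N + 1 - b) * w \<le> (m + N) * 1" using 2 by simp
    show "m * z + s * x + (m - s) * 1 \<le> (m + N) * z" using Nz by (simp add: c_def algebra_simps)
    show "(m - s) * (w + 1) \<le> (m + N) * w" using w by (simp add: c_def algebra_simps)
  qed
qed

text \<open>
  With \<open>y = 1\<close> three of the equations determine \<open>x\<close>, \<open>z\<close>, \<open>w\<close> as functions of \<open>l\<close>; the remaining
  one, \<open>f l = 0\<close>, has a root beyond \<open>m + n - 1\<close> by the intermediate value theorem.
\<close>

lemma template_solution:
  fixes m n b :: real
  assumes m: "3 \<le> m" and b: "2 \<le> b" and n: "b * m + 1 \<le> n"
  shows "\<exists>l x y z w. m + n - 1 < l \<and> 0 < x \<and> 0 < y \<and> 0 < z \<and> 0 < w \<and>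
    b * (x + z) = l * x \<and> n * y + b * z + (n - b) * w = l * y \<and>
    m * z + x + (m - 1) * y = l * z \<and> (m - 1) * (w + y) = l * w"
proof -
  define c where "c = m - 1"
  \<comment> \<open>With \<open>y = 1\<close>, \<open>W\<close> solves the fourth equation,
    \<open>Z\<close> the third after eliminating \<open>x = b * Z l / (l - b)\<close> by the first,
    and \<open>f\<close> is the difference of the two sides of the second.\<close>
  define W where "W l = c / (l - c)" for l :: real
  define Z where "Z l = c / (l - m - b / (l - b))" for l :: real
  define f where "f l = l - n - b * Z l - (n - b) * W l" for l :: real
  have "3 * b \<le> b * m" using m b by (simp add: mult.commute)
  then have nb: "3 * b + 1 \<le> n" using n by simp
  have c: "c \<ge> 2" using m by (simp add: c_def)
  have dW: "l - c \<ge> n" if "m + n - 1 \<le> l" for l using that by (simp add: c_def)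
  have lb: "l - b > b" if "m + n - 1 \<le> l" for l using that nb m b by simp
  have frac: "b / (l - b) < 1" "0 < b / (l - b)" if "m + n - 1 \<le> l" for l
    using lb[OF that] b by auto
  have dZ: "l - m - b / (l - b) > 0" if "m + n - 1 \<le> l" for l
    using that frac[OF that] nb b by simp
  \<comment> \<open>Here \<open>l - c = n\<close> and \<open>l - n = c\<close>, so \<open>f\<close>
    would vanish if \<open>Z l\<close> were \<open>c / n\<close> like \<open>W l\<close>; but the
    denominator of \<open>Z l\<close> is \<open>n - 1 - b / (l - b)\<close>, which makes
    \<open>Z l\<close> larger.\<close>
  have "f (m + n - 1) < 0"
  proof -
    let ?l = "m + n - 1"
    have W: "W ?l = c / n" by (simp add: W_def c_def)
    have "Z ?l > c / n"
      unfolding Z_def using dZ[of ?l] frac[of ?l] c nb b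
      by (intro divide_strict_left_mono mult_pos_pos) auto
    then have "b * Z ?l > b * (c / n)" using b by (intro mult_strict_left_mono) auto
    moreover have "b * (c / n) + (n - b) * (c / n) = c"
      using nb b by (simp add: field_simps)
    ultimately show ?thesis by (simp add: f_def W c_def)
  qed
  \<comment> \<open>At this endpoint \<open>Z\<close> and \<open>W\<close> are at most 1, so
    \<open>f\<close> is at least \<open>2 * m\<close>.\<close>
  moreover have "f (2 * (m + n)) > 0"
  proof -
    define L where "L = 2 * (m + n)"
    have l: "m + n - 1 \<le> L" using m nb b by (simp add: L_def)
    have "c \<le> L - m - t" if "t < 1" for t
      using that m nb b by (simp add: c_def L_def)
    from this[OF frac(1)[OF l]] have "c \<le> L - m - b / (L - b)" .
    then have "Z L \<le> 1" unfolding Z_def using dZ[OF l] by (subst divide_le_eq_1_pos) auto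
    then have bZ: "b * Z L \<le> b" using b by simp
    have "W L \<le> 1" unfolding W_def using dW[OF l] nb b m by (simp add: divide_le_eq c_def L_def)
    then have bW: "(n - b) * W L \<le> n - b" using nb b by (intro mult_left_le) auto
    have "L - n - p - q > 0" if "p \<le> b" "q \<le> n - b" for p q
      using that m nb b by (simp add: L_def)
    from this[OF bZ bW] have "f L > 0" by (simp add: f_def)
    then show ?thesis by (simp only: L_def)
  qed
  moreover have "continuous_on {m + n - 1..2 * (m + n)} f"
  proof -
    have "l - c \<noteq> 0" "l - b \<noteq> 0" "l - m - b / (l - b) \<noteq> 0" if "m + n - 1 \<le> l" for l
      using dW[OF that] lb[OF that] dZ[OF that] nb b by auto
    then show ?thesis unfolding f_def W_def Z_def by (intro continuous_intros) auto
  qed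
  ultimately obtain l where l: "m + n - 1 \<le> l" "f l = 0"
    using IVT'[of f "m + n - 1" 0 "2 * (m + n)"] m nb b by auto
  with \<open>f (m + n - 1) < 0\<close> have "m + n - 1 < l" by (cases "l = m + n - 1") auto
  define x where "x = b * Z l / (l - b)"
  have Z: "Z l > 0" using dZ[OF l(1)] c by (simp add: Z_def)
  have W: "W l > 0" using dW[OF l(1)] c nb b by (simp add: W_def)
  have x: "x > 0" "(l - b) * x = b * Z l" using Z lb[OF l(1)] b by (auto simp: x_def)
  have "(l - m - b / (l - b)) * Z l = c" using dZ[OF l(1)] by (simp add: Z_def)
  then have Z_eq: "(l - m) * Z l - x = c" by (simp add: x_def algebra_simps)
  have W_eq: "(l - c) * W l = c" using dW[OF l(1)] nb b by (simp add: W_def)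
  show ?thesis
  proof (rule exI[of _ l], rule exI[of _ x], rule exI[of _ 1], rule exI[of _ "Z l"],
      rule exI[of _ "W l"], intro conjI)
    show "m + n - 1 < l" by fact
    show "0 < x" "0 < Z l" "0 < W l" by fact+
    show "(0::real) < 1" by simp
    show "b * (x + Z l) = l * x" using x(2) by (simp add: algebra_simps)
    show "n * 1 + b * Z l + (n - b) * W l = l * 1" using l(2) by (simp add: f_def)
    show "m * Z l + x + (m - 1) * 1 = l * Z l" using Z_eq by (simp add: c_def algebra_simps)
    show "(m - 1) * (W l + 1) = l * W l" using W_eq by (simp add: c_def algebra_simps)
  qed
qed

section \<open>Block structure of the graphs \<open>template s b m n\<close>\<close>

definition template :: "nat \<Rightarrow> nat \<Rightarrow> nat \<Rightarrow> nat \<Rightarrow> ((nat + nat) + (nat + nat)) pair_pre_digraph" where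
  "template s b m n = fst (complete_bipartite s b \<nabla> complete_bipartite (m - s) (n - b))"

text \<open>The blocks are listed in the order A1, B1, A2, B2: the outer constructor selects the
  factor, the inner one its side.\<close>

lemma pverts_template:
  "pverts (template s b m n) =
    Inl ` Inl ` {..<s} \<union> Inl ` Inr ` {..<b} \<union> Inr ` Inl ` {..<m - s} \<union> Inr ` Inr ` {..<n - b}"
  by (auto simp: template_def complete_bipartite_def Let_def)

lemma parcs_template:
  "parcs (template s b m n) =
    Inl ` Inl ` {..<s} \<times> Inl ` Inr ` {..<b} \<union> Inl ` Inr ` {..<b} \<times> Inl ` Inl ` {..<s} \<union>
    (Inr ` Inl ` {..<m - s} \<times> Inr ` Inr ` {..<n - b} \<union> Inr ` Inr ` {..<n - b} \<times> Inr ` Inl ` {..<m - s}) \<union>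
    Inr ` Inl ` {..<m - s} \<times> Inl ` Inr ` {..<b} \<union> Inl ` Inr ` {..<b} \<times> Inr ` Inl ` {..<m - s}"
  by (simp add: template_def complete_bipartite_def Let_def image_Un map_prod_surj_on[OF refl refl])

lemma Times_Image_singleton: "(X \<times> Y) `` {p} = (if p \<in> X then Y else {})"
  by auto

lemma Inl_Inr_mem_image [simp]: "Inl p \<notin> Inr ` Y" "Inr q \<notin> Inl ` X"
  by auto

lemma template_Image:
  "i < s \<Longrightarrow> parcs (template s b m n) `` {Inl (Inl i)} = Inl ` Inr ` {..<b}"
  "i < b \<Longrightarrow> parcs (template s b m n) `` {Inl (Inr i)} = Inl ` Inl ` {..<s} \<union> Inr ` Inl ` {..<m - s}"
  "i < m - s \<Longrightarrow> parcs (template s b m n) `` {Inr (Inl i)} = Inl ` Inr ` {..<b} \<union> Inr ` Inr ` {..<n - b}"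
  "i < n - b \<Longrightarrow> parcs (template s b m n) `` {Inr (Inr i)} = Inr ` Inl ` {..<m - s}"
  by (simp_all add: parcs_template Un_Image Times_Image_singleton inj_image_mem_iff Un_commute)

lemma parcs_template_subset:
  "parcs (template s b m n) \<subseteq> pverts (template s b m n) \<times> pverts (template s b m n)"
  unfolding parcs_template pverts_template by blast

lemma pair_fin_digraph_template: "pair_fin_digraph (template s b m n)"
proof
  show fin: "finite (pverts (template s b m n))" by (simp add: pverts_template)
  show "finite (parcs (template s b m n))"
    by (rule finite_subset[OF parcs_template_subset finite_cartesian_product[OF fin fin]])
qed (use parcs_template_subset in force)+

text \<open>Functions constant on the blocks suffice, because the blocks form an equitable
  partition. The arguments follow the block order A1, B1, A2, B2, hence \<open>z\<close> before
  \<open>y\<close>.\<close>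

fun weights :: "real \<Rightarrow> real \<Rightarrow> real \<Rightarrow> real \<Rightarrow> ('a + 'b) + ('c + 'd) \<Rightarrow> real" where
  "weights x z y w (Inl (Inl _)) = x"
| "weights x z y w (Inl (Inr _)) = z"
| "weights x z y w (Inr (Inl _)) = y"
| "weights x z y w (Inr (Inr _)) = w"

lemma sum_weights [simp]:
  "sum (weights x z y w) (Inl ` Inl ` I) = real (card I) * x"
  "sum (weights x z y w) (Inl ` Inr ` J) = real (card J) * z"
  "sum (weights x z y w) (Inr ` Inl ` K) = real (card K) * y"
  "sum (weights x z y w) (Inr ` Inr ` L) = real (card L) * w"
  by (simp_all add: sum.reindex)

lemma card_Un_Inl_Inr:
  "finite X \<Longrightarrow> finite Y \<Longrightarrow> card (Inl ` X \<union> Inr ` Y) = card X + card Y"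
  by (subst card_Un_disjoint) (auto simp: card_image)

lemma sum_Un_Inl_Inr:
  "finite X \<Longrightarrow> finite Y \<Longrightarrow> sum f (Inl ` X \<union> Inr ` Y) = sum f (Inl ` X) + sum f (Inr ` Y)"
  by (rule sum.union_disjoint) auto

text \<open>This and the next three lemmas are the rows of the quotient matrix on the four blocks;
  they yield the left-hand sides in \<open>template_solution\<close> and
  \<open>template_supersolution\<close>. The bounds on \<open>s\<close> and \<open>b\<close> turn
  truncated subtraction into real subtraction.\<close>

lemma signless_apply_template_A1:
  assumes "i < s" "s \<le> m" "b \<le> n"
  shows "signless_apply (template s b m n) (weights x z y w) (Inl (Inl i)) = b * (x + z)"
  using assms
  by (simp add: signless_apply_def template_Image card_Un_Inl_Inr sum_Un_Inl_Inr card_image of_nat_diff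
      distrib_left distrib_right left_diff_distrib)

lemma signless_apply_template_B1:
  assumes "i < b" "s \<le> m" "b \<le> n"
  shows "signless_apply (template s b m n) (weights x z y w) (Inl (Inr i)) = real m * z + s * x + (real m - s) * y"
  using assms
  by (simp add: signless_apply_def template_Image card_Un_Inl_Inr sum_Un_Inl_Inr card_image of_nat_diff
      distrib_left distrib_right left_diff_distrib)

lemma signless_apply_template_A2:
  assumes "i < m - s" "s \<le> m" "b \<le> n"
  shows "signless_apply (template s b m n) (weights x z y w) (Inr (Inl i)) = real n * y + b * z + (real n - b) * w"
  using assms
  by (simp add: signless_apply_def template_Image card_Un_Inl_Inr sum_Un_Inl_Inr card_image of_nat_diff
      distrib_left distrib_right left_diff_distrib)

lemma signless_apply_template_B2:
  assumes "i < n - b" "s \<le> m" "b \<le> n"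
  shows "signless_apply (template s b m n) (weights x z y w) (Inr (Inr i)) = (real m - s) * (w + y)"
  using assms
  by (simp add: signless_apply_def template_Image card_Un_Inl_Inr sum_Un_Inl_Inr card_image of_nat_diff
      distrib_left distrib_right left_diff_distrib)

lemmas signless_apply_template =
  signless_apply_template_A1 signless_apply_template_B1
  signless_apply_template_A2 signless_apply_template_B2

lemma ball_pverts_template:
  "(\<forall>p\<in>pverts (template s b m n). P p) \<longleftrightarrow>
    (\<forall>i<s. P (Inl (Inl i))) \<and> (\<forall>i<b. P (Inl (Inr i))) \<and>
    (\<forall>i<m - s. P (Inr (Inl i))) \<and> (\<forall>i<n - b. P (Inr (Inr i)))"
  unfolding pverts_template by blast

text \<open>\<open>S\<close> is sent to the block A1 and \<open>B1\<close> to the block of the same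
  name. Between the two sides the template lacks only the pairs from A1 to B2, and \<open>G\<close>
  has no arc there because all neighbours of \<open>S\<close> lie in \<open>B1\<close>.\<close>

lemma template_embedding:
  assumes bip: "bipartition G A B" and fin: "finite A" "finite B"
    and S: "S \<subseteq> A" and N: "parcs G `` S \<subseteq> B1" "B1 \<subseteq> B"
    and sym: "sym (parcs G)"
  obtains \<phi> where "bij_betw \<phi> (pverts G) (pverts (template (card S) (card B1) (card A) (card B)))"
    "\<And>a b. (a, b) \<in> parcs G \<Longrightarrow> (\<phi> a, \<phi> b) \<in> parcs (template (card S) (card B1) (card A) (card B))"
proof -
  have finS: "finite S" "finite B1" using S N fin by (auto intro: finite_subset)
  obtain f1 where f1: "bij_betw f1 S {..<card S}"
    using ex_bij_betw_finite_nat[OF finS(1)] by (auto simp: lessThan_atLeast0)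
  obtain f2 where f2: "bij_betw f2 B1 {..<card B1}"
    using ex_bij_betw_finite_nat[OF finS(2)] by (auto simp: lessThan_atLeast0)
  obtain f3 where f3: "bij_betw f3 (A - S) {..<card A - card S}"
    using ex_bij_betw_finite_nat[of "A - S"] fin S finS
    by (auto simp: lessThan_atLeast0 card_Diff_subset)
  obtain f4 where f4: "bij_betw f4 (B - B1) {..<card B - card B1}"
    using ex_bij_betw_finite_nat[of "B - B1"] fin N finS
    by (auto simp: lessThan_atLeast0 card_Diff_subset)
  let ?H = "template (card S) (card B1) (card A) (card B)"
  define \<phi> where "\<phi> u = (if u \<in> S then Inl (Inl (f1 u)) else if u \<in> B1 then Inl (Inr (f2 u))
    else if u \<in> A then Inr (Inl (f3 u)) else Inr (Inr (f4 u)))" for u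
  have AB: "A \<inter> B = {}" "pverts G = S \<union> B1 \<union> (A - S) \<union> (B - B1)"
    and arcs: "parcs G \<subseteq> A \<times> B \<union> B \<times> A"
    using bip S N by (auto simp: bipartition_def)
  have \<phi>: "\<And>u. u \<in> S \<Longrightarrow> \<phi> u = Inl (Inl (f1 u))" "\<And>u. u \<in> B1 \<Longrightarrow> \<phi> u = Inl (Inr (f2 u))"
    "\<And>u. u \<in> A - S \<Longrightarrow> \<phi> u = Inr (Inl (f3 u))" "\<And>u. u \<in> B - B1 \<Longrightarrow> \<phi> u = Inr (Inr (f4 u))"
    using AB S N by (auto simp: \<phi>_def)
  have block: "bij_betw \<phi> X (c ` Y)"
    if "bij_betw f X Y" "inj c" "\<And>u. u \<in> X \<Longrightarrow> \<phi> u = c (f u)" for f X Y and c :: "nat \<Rightarrow> _"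
  proof -
    have "bij_betw (c \<circ> f) X (c ` Y)"
      using that(1,2) by (intro bij_betw_trans[of f X Y]) (auto simp: bij_betw_def inj_on_def)
    then show ?thesis using that(3) by (simp cong: bij_betw_cong)
  qed
  have "bij_betw \<phi> (S \<union> B1 \<union> (A - S) \<union> (B - B1)) (pverts ?H)"
    unfolding pverts_template image_image
  proof (intro bij_betw_combine)
    show "bij_betw \<phi> S ((\<lambda>i. Inl (Inl i)) ` {..<card S})"
      by (rule block[OF f1]) (auto simp: \<phi> inj_def)
    show "bij_betw \<phi> B1 ((\<lambda>i. Inl (Inr i)) ` {..<card B1})"
      by (rule block[OF f2]) (auto simp: \<phi> inj_def)
    show "bij_betw \<phi> (A - S) ((\<lambda>i. Inr (Inl i)) ` {..<card A - card S})"
      by (rule block[OF f3]) (auto simp: \<phi> inj_def)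
    show "bij_betw \<phi> (B - B1) ((\<lambda>i. Inr (Inr i)) ` {..<card B - card B1})"
      by (rule block[OF f4]) (auto simp: \<phi> inj_def)
  qed auto
  moreover have "(\<phi> a, \<phi> b) \<in> parcs ?H" if ab: "(a, b) \<in> parcs G" for a b
  proof -
    have AtoB: "(\<phi> a, \<phi> b) \<in> parcs ?H \<and> (\<phi> b, \<phi> a) \<in> parcs ?H"
      if ab: "(a, b) \<in> parcs G" and a: "a \<in> A" for a b
    proof -
      have b: "b \<in> B" using ab a arcs AB by auto
      have lt1: "f1 u < card S" if "u \<in> S" for u using that f1 by (auto simp: bij_betw_def)
      have lt2: "f2 u < card B1" if "u \<in> B1" for u using that f2 by (auto simp: bij_betw_def)
      have lt3: "f3 u < card A - card S" if "u \<in> A - S" for u using that f3 by (auto simp: bij_betw_def)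
      have lt4: "f4 u < card B - card B1" if "u \<in> B - B1" for u using that f4 by (auto simp: bij_betw_def)
      consider "a \<in> S" "b \<in> B1" | "a \<in> A - S" "b \<in> B1" | "a \<in> A - S" "b \<in> B - B1"
        using a b ab N by auto
      then show ?thesis
        by cases (use lt1 lt2 lt3 lt4 in \<open>auto simp: \<phi> template_def complete_bipartite_def Let_def\<close>)
    qed
    show ?thesis
    proof (cases "a \<in> A")
      case False
      then have "b \<in> A" "(b, a) \<in> parcs G" using ab arcs sym by (auto dest: symD)
      then show ?thesis using AtoB by blast
    qed (use AtoB ab in blast)
  qed
  ultimately show thesis using that AB(2) by metis
qed

text \<open>Matching neighbourhoods at every vertex make \<open>map_prod \<phi> \<phi>\<close> carry
  the arcs of \<open>G\<close> onto those of \<open>H\<close>; as arcs are pairs, heads and tails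
  are respected automatically.\<close>

lemma digraph_isoI:
  assumes G: "pair_wf_digraph G" and H: "pair_wf_digraph H"
    and \<phi>: "bij_betw \<phi> (pverts G) (pverts H)"
    and nbrs: "\<And>u. u \<in> pverts G \<Longrightarrow> parcs H `` {\<phi> u} = \<phi> ` (parcs G `` {u})"
  shows "digraph_iso (with_proj G) (with_proj H)"
proof -
  interpret G: pair_wf_digraph G by fact
  interpret H: pair_wf_digraph H by fact
  define f where "f = \<lparr>iso_verts = \<phi>, iso_arcs = map_prod \<phi> \<phi>, iso_head = snd, iso_tail = fst\<rparr>"
  have inj: "inj_on \<phi> (pverts G)" using \<phi> by (simp add: bij_betw_def)
  have "inj_on (map_prod \<phi> \<phi>) (parcs G)"
    by (rule inj_on_subset[OF map_prod_inj_on[OF inj inj]]) (auto dest: G.in_arcsD1 G.in_arcsD2)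
  then have "pre_digraph.digraph_isomorphism (with_proj G) f"
    using inj G.wf_digraph by (simp add: pre_digraph.digraph_isomorphism_def f_def)
  moreover have "parcs H = map_prod \<phi> \<phi> ` parcs G"
  proof (intro equalityI subrelI)
    fix p q assume pq: "(p, q) \<in> parcs H"
    then have "p \<in> \<phi> ` pverts G" using H.in_arcsD1[OF pq] \<phi> by (simp add: bij_betw_def)
    then obtain u where u: "u \<in> pverts G" "p = \<phi> u" by blast
    then have "q \<in> \<phi> ` (parcs G `` {u})" using pq nbrs[OF u(1)] by auto
    then show "(p, q) \<in> map_prod \<phi> \<phi> ` parcs G" using u by force
  next
    fix p q assume "(p, q) \<in> map_prod \<phi> \<phi> ` parcs G"
    then obtain a b where ab: "(a, b) \<in> parcs G" "p = \<phi> a" "q = \<phi> b" by auto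
    then have "\<phi> b \<in> parcs H `` {\<phi> a}" using nbrs[OF G.in_arcsD1[OF ab(1)]] by auto
    then show "(p, q) \<in> parcs H" using ab by simp
  qed
  then have "with_proj H = app_iso f (with_proj G)"
    using \<phi> by (simp add: with_proj_def app_iso_def f_def bij_betw_def)
  ultimately show ?thesis by (auto simp: digraph_iso_def)
qed

section \<open>The alternative between expansion and spectral comparison with a template\<close>

theorem theorem1p1:
  fixes k m n :: nat
    and G :: "'a pair_pre_digraph"
    and A B :: "'a set"
  assumes "k \<ge> 3" and "m \<ge> 3" and "n \<ge> (k - 1) * m + 1"
    and "pair_graph G"
    and "Digraph_Component.connected (with_proj G)"
    and "bipartition G A B"
    and "card A = m" and "card B = n"
    and "signless_spectral_radius G \<ge> signless_spectral_radius (extremal_graph k m n)"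
  shows "(\<exists>T. undirected_spanning_tree T G \<and> (\<forall>v\<in>A. degree_of T v \<ge> k)) \<or>
    digraph_iso (with_proj G) (with_proj (extremal_graph k m n))"
proof (cases "\<forall>S\<subseteq>A. S \<noteq> {} \<longrightarrow> (k - 1) * card S < card (parcs G `` S)")
  case True
  then show ?thesis
    using spanning_tree_if_expanding[of G A B k] assms by simp
next
  case False
  interpret G: pair_graph G by fact
  note conn = \<open>Digraph_Component.connected (with_proj G)\<close>
  have AB: "pverts G = A \<union> B" "A \<inter> B = {}" and arcs: "parcs G \<subseteq> A \<times> B \<union> B \<times> A"
    using \<open>bipartition G A B\<close> by (auto simp: bipartition_def)
  have fin: "finite A" "finite B" using AB G.pair_finite_verts by auto
  have symG: "sym (parcs G)" using G.arcs_symmetric by (auto simp: sym_def)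
  obtain S where S: "S \<subseteq> A" "S \<noteq> {}" and S_le: "card (parcs G `` S) \<le> (k - 1) * card S"
    using False by (auto simp: not_less)
  define s where "s = card S"
  define b where "b = (k - 1) * s"
  have "s > 0" using S fin by (auto simp: s_def card_gt_0_iff intro: finite_subset)
  have NB: "parcs G `` S \<subseteq> B" using S arcs AB by auto
  \<comment> \<open>If \<open>S\<close> were all of \<open>A\<close>, connectedness would put every
    vertex of \<open>B\<close> into its image, so \<open>n\<close> would be at most
    \<open>(k - 1) * m\<close>.\<close>
  have "s < m"
  proof (rule ccontr)
    assume "\<not> s < m"
    then have "S = A" using S fin \<open>card A = m\<close> by (intro card_seteq) (auto simp: s_def)
    have "B \<subseteq> parcs G `` A"
    proof
      fix y assume y: "y \<in> B"
      obtain a where a: "a \<in> A" using S by auto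
      have "(a, y) \<in> (parcs G)\<^sup>*" using conn y a AB by (auto simp: G.connected_iff_rtrancl)
      moreover have "a \<noteq> y" using a y AB by auto
      ultimately obtain c where "(c, y) \<in> parcs G" by (metis rtranclE)
      then show "y \<in> parcs G `` A" using arcs y AB by auto
    qed
    then have "n \<le> card (parcs G `` A)"
      using \<open>card B = n\<close> fin NB \<open>S = A\<close> by (metis card_mono finite_subset)
    then show False using S_le \<open>S = A\<close> \<open>card A = m\<close> assms(3) by simp
  qed
  have "b \<le> (k - 1) * m" using \<open>s < m\<close> by (simp add: b_def)
  then have "b < n" using assms(3) by simp
  \<comment> \<open>The neighbourhood of \<open>S\<close> is padded inside \<open>B\<close> to
    exactly \<open>b\<close> vertices, so that for given \<open>k\<close>, \<open>m\<close>,
    \<open>n\<close> the template depends on \<open>s\<close> alone.\<close>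
  then obtain B1 where B1: "parcs G `` S \<subseteq> B1" "B1 \<subseteq> B" "card B1 = b"
    using exists_subset_between[of "parcs G `` S" b B] S_le NB fin \<open>card B = n\<close>
    by (auto simp: b_def s_def)
  let ?H = "template s b m n"
  obtain \<phi> where \<phi>: "bij_betw \<phi> (pverts G) (pverts ?H)"
    and \<phi>_arcs: "\<And>a b'. (a, b') \<in> parcs G \<Longrightarrow> (\<phi> a, \<phi> b') \<in> parcs ?H"
    using template_embedding[OF \<open>bipartition G A B\<close> fin S(1) B1(1,2) symG]
    by (auto simp: B1(3) \<open>card A = m\<close> \<open>card B = n\<close> simp flip: s_def)
  have \<phi>_inj: "inj_on \<phi> (pverts G)" "\<phi> ` pverts G \<subseteq> pverts ?H"
    using \<phi> by (auto simp: bij_betw_def)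
  have "pverts G \<noteq> {}" using AB S by auto
  obtain x where x_nz: "\<exists>u\<in>pverts G. x u \<noteq> 0"
    and x: "\<forall>u\<in>pverts G. signless_apply G x u = signless_spectral_radius G * x u"
    using signless_spectral_radius_eigenvector[OF G.pair_fin_digraph \<open>bipartition G A B\<close>
        \<open>pverts G \<noteq> {}\<close>] by (elim exE conjE)
  obtain u where u: "u \<in> pverts G" "x u \<noteq> 0" using x_nz by (elim bexE)
  note rigid = signless_embedding_rigid[OF \<open>pair_graph G\<close> pair_fin_digraph_template conn
      \<phi>_inj \<phi>_arcs _ _ bspec[OF x] u]
  define k' where "k' = k - 1"
  have k': "k' \<ge> 2" "n \<ge> k' * m + 1" using assms(1,3) by (auto simp: k'_def)
  have "k' * 1 \<le> k' * m" using assms(2) by (intro mult_le_mono2) simp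
  then have "k' < n" using k'(2) by linarith
  \<comment> \<open>The left-hand side is \<open>(n - k) + 1\<close> with truncated subtraction, so
    the equation needs \<open>k\<close> to be at most \<open>n\<close>.\<close>
  then have "n - k + 1 = n - k'" using assms(1) unfolding k'_def by linarith
  then have ext: "extremal_graph k m n = template 1 k' m n"
    by (simp add: extremal_graph_def template_def k'_def)
  have "real (k' * m + 1) \<le> real n" using k'(2) by (simp only: of_nat_le_iff)
  then have k'n: "real k' * real m + 1 \<le> real n" by simp
  obtain l x1 y1 z1 w1 :: real where l: "real m + real n - 1 < l"
    and pos: "0 < x1" "0 < y1" "0 < z1" "0 < w1"
    and eqs: "real k' * (x1 + z1) = l * x1"
      "real n * y1 + real k' * z1 + (real n - real k') * w1 = l * y1"
      "real m * z1 + x1 + (real m - 1) * y1 = l * z1" "(real m - 1) * (w1 + y1) = l * w1"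
    using template_solution[of "real m" "real k'" "real n"] assms(2) k'(1) k'n by auto
  let ?v = "weights x1 z1 y1 w1"
  have ext_eq: "\<forall>p\<in>pverts (template 1 k' m n). signless_apply (template 1 k' m n) ?v p = l * ?v p"
    unfolding ball_pverts_template
    using eqs assms(2) \<open>k' < n\<close> by (simp add: signless_apply_template)
  interpret E: pair_fin_digraph "template 1 k' m n" by (rule pair_fin_digraph_template)
  have "l \<le> signless_spectral_radius (template 1 k' m n)"
  proof (rule E.signless_spectral_radius_ge)
    show "Inl (Inl 0) \<in> pverts (template 1 k' m n)" by (simp add: pverts_template)
    show "?v (Inl (Inl 0)) \<noteq> 0" using pos by simp
  qed (use ext_eq in auto)
  then have l_le: "l \<le> signless_spectral_radius G" using assms(9) by (simp add: ext)
  have vpos: "weights x z y w p > 0" if "0 < x" "0 < y" "0 < z" "0 < w"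
    for x y z w and p :: "(nat + nat) + (nat + nat)"
    using that by (cases "(x, z, y, w, p)" rule: weights.cases) auto
  show ?thesis
  proof (cases "s = 1")
    \<comment> \<open>The template is now the extremal graph, with a positive eigenvector for
      \<open>l\<close>, and \<open>l\<close> is at most the spectral radius of \<open>G\<close>.
      Rigidity makes \<open>\<phi>\<close> preserve full neighbourhoods, hence an
      isomorphism.\<close>
    case True
    then have "b = k'" by (simp add: b_def k'_def)
    have "digraph_iso (with_proj G) (with_proj ?H)"
    proof (rule digraph_isoI[OF G.pair_wf_digraph
          pair_fin_digraph.axioms(1)[OF pair_fin_digraph_template] \<phi>])
      show "parcs ?H `` {\<phi> a} = \<phi> ` (parcs G `` {a})" if "a \<in> pverts G" for a
        by (rule rigid(2)[where v = ?v and l = l])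
          (use that vpos[OF pos] ext_eq l_le in \<open>auto simp: True \<open>b = k'\<close>\<close>)
    qed
    then show ?thesis by (simp add: ext True \<open>b = k'\<close>)
  next
    \<comment> \<open>Now \<open>s\<close> is at least 2, and the supersolution has the factor
      \<open>m + N\<close>, that is \<open>m + n - 1\<close>. The spectral radius of
      \<open>G\<close> exceeds it because it is at least \<open>l\<close>, whereas rigidity would
      force equality.\<close>
    case False
    define N where "N = real n - 1"
    have N: "real k' * real m \<le> N" using k'n by (simp add: N_def)
    have "2 * real m \<le> real k' * real m" using k' by (intro mult_right_mono) auto
    then have "2 * real m \<le> N" using N by simp
    moreover have "real s * (real k' * m) \<le> real s * N" using N by (intro mult_left_mono) auto
    then have "real b * real m \<le> real s * N" by (simp add: b_def k'_def mult_ac)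
    moreover have "2 \<le> real s" "real s \<le> real m - 1" using False \<open>s > 0\<close> \<open>s < m\<close> by simp_all
    ultimately obtain x2 y2 z2 w2 :: real where pos2: "0 < x2" "0 < y2" "0 < z2" "0 < w2"
      and ineqs: "real b * (x2 + z2) \<le> (m + N) * x2"
        "(N + 1) * y2 + real b * z2 + (N + 1 - real b) * w2 \<le> (m + N) * y2"
        "real m * z2 + real s * x2 + (real m - real s) * y2 \<le> (m + N) * z2"
        "(real m - real s) * (w2 + y2) \<le> (m + N) * w2"
      using template_supersolution[of "real s" "real m" N "real b"] by auto
    let ?v2 = "weights x2 z2 y2 w2"
    have "\<forall>p\<in>pverts ?H. signless_apply ?H ?v2 p \<le> (m + N) * ?v2 p"
      unfolding ball_pverts_template
      using ineqs \<open>s < m\<close> \<open>b < n\<close> by (simp add: signless_apply_template N_def)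
    moreover have "real m + N < signless_spectral_radius G"
      using l l_le by (simp add: N_def)
    ultimately have "signless_spectral_radius G = m + N"
      by (intro rigid(1)[where v = ?v2]) (use vpos[OF pos2] in auto)
    then show ?thesis using \<open>real m + N < signless_spectral_radius G\<close> by simp
  qed
qed

end
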